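(* Let $(\mathcal{X},\mathcal{B}(\mathcal{X}))$ be a measurable space, $\mathcal{P}$ the family of all nondegenerate probability measures on it, $\Theta$ a parameter space, $G$ a group of measurable transformations of $\mathcal{X}$ onto itself, and $H_G=\{h_g : g\in G\}$ the induced group of transformations $h_g:\Theta\to\Theta$. Let $d$ be any pseudometric on $\mathcal{P}$ such that $$\sup_{P,Q\in\mathcal{P}} d(P,Q)=1$$ and such that for all $P,Q_1,Q_2\in\mathcal{P}$ and all $\alpha$ with $0<\alpha<1$, $$d(\alpha P+(1-\alpha)Q_1,\ \alpha P+(1-\alpha)Q_2)\le 1-\alpha ,$$ and let $D$ be any pseudometric on $\Theta$ such that $$\sup_{\theta_1,\theta_2\in\Theta} D(\theta_1,\theta_2)=\infty .$$ Assume that the set $$G_1=\Big\{g\in G:\ \lim_{n\to\infty}\inf_{\theta\in\Theta} D(\theta,h_{g^n}(\theta))=\infty\Big\}$$ is nonempty. Then for every $G$-equivariant functional $T:\mathcal{P}\to\Theta$ and every $P\in\mathcal{P}$, $$\varepsilon^*(T,P,d,D)\le \frac{1-\Delta(P)}{2}.$$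
   Context: For $P\in\mathcal{P}$ and $g\in G$, the measure $P^g$ is defined by $P^g(B)=P(g^{-1}(B))$ for $B\in\mathcal{B}(\mathcal{X})$. The unit element of $G$ (the identity transformation) is denoted $\iota$, and $g^n$ denotes the $n$-fold composition of $g$ with itself. The group $G$ induces a group $H_G=\{h_g:g\in G\}$ of transformations of $\Theta$. A functional $T:\mathcal{P}\to\Theta$ is called $G$-equivariant if $T(P^g)=h_g(T(P))$ for all $g\in G$ and all $P\in\mathcal{P}$. The breakdown point of $T$ at $P$ with respect to $d$ and $D$ is $$\varepsilon^*(T,P,d,D)=\inf\Big\{\varepsilon>0:\ \sup_{Q\in\mathcal{P},\ d(P,Q)<\varepsilon} D(T(P),T(Q))=\infty\Big\}.$$ For a set $B\in\mathcal{B}(\mathcal{X})$, $g_{|B}$ denotes the restriction of $g$ to $B$, and $$\Delta(P)=\sup\{P(B):\ B\in\mathcal{B}(\mathcal{X}),\ g_{|B}=\iota_{|B}\ \text{for some } g\in G_1\}.$$ *)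

theory Defs
  imports "HOL-Probability.Probability" "HOL-Algebra.Group_Action"
begin

text \<open>
  A measurable space is given by a measure \<open>M\<close> of which only \<open>space M\<close> and \<open>sets M\<close> matter.
  A probability measure is degenerate if it is a point mass; \<open>return M x\<close> is used rather than
  \<open>P {x} = 1\<close> because singletons need not be measurable.
\<close>

definition nondegenerate_probs :: "'x measure \<Rightarrow> 'x measure set" where
  "nondegenerate_probs M =
     {P. prob_space P \<and> sets P = sets M \<and> (\<forall>x\<in>space M. P \<noteq> return M x)}"

definition mixture :: "real \<Rightarrow> 'x measure \<Rightarrow> 'x measure \<Rightarrow> 'x measure" where
  "mixture \<alpha> P Q = measure_of (space P) (sets P)
     (\<lambda>B. ennreal \<alpha> * emeasure P B + ennreal (1 - \<alpha>) * emeasure Q B)"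

lemma space_mixture [simp]: "space (mixture \<alpha> P Q) = space P"
  and sets_mixture [simp]: "sets (mixture \<alpha> P Q) = sets P"
  by (simp_all add: mixture_def)

lemma emeasure_mixture:
  assumes "sets P = sets Q" "B \<in> sets P"
  shows "emeasure (mixture \<alpha> P Q) B
    = ennreal \<alpha> * emeasure P B + ennreal (1 - \<alpha>) * emeasure Q B"
proof (rule emeasure_measure_of[OF mixture_def])
  show "countably_additive (sets (mixture \<alpha> P Q))
    (\<lambda>B. ennreal \<alpha> * emeasure P B + ennreal (1 - \<alpha>) * emeasure Q B)"
    using assms(1)
    by (auto intro!: countably_additiveI
        simp: suminf_add[symmetric] ennreal_suminf_cmult suminf_emeasure)
qed (use assms sets.space_closed in \<open>auto simp: positive_def\<close>)

definition pseudometric_on :: "'a set \<Rightarrow> ('a \<Rightarrow> 'a \<Rightarrow> real) \<Rightarrow> bool" where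
  "pseudometric_on S d \<longleftrightarrow>
     (\<forall>x\<in>S. \<forall>y\<in>S. 0 \<le> d x y) \<and>
     (\<forall>x\<in>S. d x x = 0) \<and>
     (\<forall>x\<in>S. \<forall>y\<in>S. d x y = d y x) \<and>
     (\<forall>x\<in>S. \<forall>y\<in>S. \<forall>z\<in>S. d x z \<le> d x y + d y z)"

text \<open>
  Transformations of a set \<open>S\<close> onto itself are elements of \<open>BijGroup S\<close>, i.e. bijections of \<open>S\<close>
  with the value \<open>undefined\<close> outside \<open>S\<close>; the product is composition, \<open>g \<otimes> f = g \<circ> f\<close> on \<open>S\<close>.
\<close>

definition measurable_transformation_group :: "'x measure \<Rightarrow> ('x \<Rightarrow> 'x) set \<Rightarrow> bool" where
  "measurable_transformation_group M G \<longleftrightarrow>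
     subgroup G (BijGroup (space M)) \<and> G \<subseteq> M \<rightarrow>\<^sub>M M"

text \<open>
  The induced group \<open>{h g | g. g \<in> G}\<close>: \<open>g \<mapsto> h g\<close> is a homomorphism of \<open>G\<close> into \<open>BijGroup \<Theta>\<close>.
\<close>

definition induced_group ::
  "'x measure \<Rightarrow> ('x \<Rightarrow> 'x) set \<Rightarrow> 't set \<Rightarrow> (('x \<Rightarrow> 'x) \<Rightarrow> 't \<Rightarrow> 't) \<Rightarrow> bool" where
  "induced_group M G \<Theta> h \<longleftrightarrow> group_action ((BijGroup (space M))\<lparr>carrier := G\<rparr>) \<Theta> h"

text \<open>\<open>distr P M g\<close> is the measure \<open>B \<mapsto> P (g\<^sup>-\<^sup>1 B)\<close> on \<open>M\<close>.\<close>

definition equivariant ::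
  "'x measure \<Rightarrow> ('x \<Rightarrow> 'x) set \<Rightarrow> (('x \<Rightarrow> 'x) \<Rightarrow> 't \<Rightarrow> 't) \<Rightarrow> 'x measure set
     \<Rightarrow> ('x measure \<Rightarrow> 't) \<Rightarrow> bool" where
  "equivariant M G h \<P> T \<longleftrightarrow> (\<forall>g\<in>G. \<forall>P\<in>\<P>. T (distr P M g) = h g (T P))"

definition G1 ::
  "'x measure \<Rightarrow> ('x \<Rightarrow> 'x) set \<Rightarrow> 't set \<Rightarrow> (('x \<Rightarrow> 'x) \<Rightarrow> 't \<Rightarrow> 't) \<Rightarrow> ('t \<Rightarrow> 't \<Rightarrow> real)
     \<Rightarrow> ('x \<Rightarrow> 'x) set" where
  "G1 M G \<Theta> h D = {g\<in>G.
     (\<lambda>n::nat. INF \<theta>\<in>\<Theta>. ereal (D \<theta> (h (g [^]\<^bsub>BijGroup (space M)\<^esub> n) \<theta>))) \<longlonglongrightarrow> \<infinity>}"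

text \<open>The value is \<open>\<infinity>\<close> if there is no \<open>\<epsilon>\<close> with infinite supremum.\<close>

definition breakdown_point ::
  "'x measure set \<Rightarrow> ('x measure \<Rightarrow> 't) \<Rightarrow> 'x measure \<Rightarrow> ('x measure \<Rightarrow> 'x measure \<Rightarrow> real)
     \<Rightarrow> ('t \<Rightarrow> 't \<Rightarrow> real) \<Rightarrow> ereal" where
  "breakdown_point \<P> T P d D = Inf (ereal ` {\<epsilon>. \<epsilon> > 0 \<and>
     (SUP Q\<in>{Q\<in>\<P>. d P Q < \<epsilon>}. ereal (D (T P) (T Q))) = \<infinity>})"

text \<open>
  The sets of which the supremum is taken lie in \<open>[0, 1]\<close> and contain \<open>0\<close> (take \<open>B = {}\<close>) as soon
  as \<open>G1\<close> is nonempty, so the real supremum is the intended one.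
\<close>

definition Delta ::
  "'x measure \<Rightarrow> ('x \<Rightarrow> 'x) set \<Rightarrow> 't set \<Rightarrow> (('x \<Rightarrow> 'x) \<Rightarrow> 't \<Rightarrow> 't) \<Rightarrow> ('t \<Rightarrow> 't \<Rightarrow> real)
     \<Rightarrow> 'x measure \<Rightarrow> real" where
  "Delta M G \<Theta> h D P = Sup {measure P B | B.
     B \<in> sets M \<and> (\<exists>g\<in>G1 M G \<Theta> h D. restrict g B = restrict \<one>\<^bsub>BijGroup (space M)\<^esub> B)}"

end

theory Submission
  imports Defs
begin

text \<open>
  Let \<open>g \<in> G1\<close> fix \<open>B\<close> pointwise, and let \<open>g\<^sup>-\<^sup>n\<close> map the law \<open>Q\<close> to \<open>Q'\<close>, where
  \<open>Q = (P + P\<^bsup>g^n\<^esup>) / 2\<close>; then \<open>Q' = (P + P\<^bsup>g^(-n)\<^esup>) / 2\<close>. On \<open>B\<close> both \<open>Q\<close> and \<open>Q'\<close> keep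
  the mass of \<open>P\<close>, so they are within about \<open>(1 - P B) / 2\<close> of \<open>P\<close>. By equivariance
  \<open>T Q = h (g^n) (T Q')\<close>, whose \<open>D\<close>-distance to \<open>T Q'\<close> tends to infinity with \<open>n\<close>, so one of
  \<open>T Q\<close>, \<open>T Q'\<close> is far from \<open>T P\<close>.
\<close>

section \<open>Nondegenerate laws and absolute continuity\<close>

lemma nondegenerate_probsD:
  assumes "P \<in> nondegenerate_probs M"
  shows "prob_space P" "sets P = sets M" "space P = space M"
  using assms sets_eq_imp_space_eq[of P M] by (auto simp: nondegenerate_probs_def)

text \<open>If \<open>Q\<close> were the point mass at \<open>x\<close>, every measurable set
  missing \<open>x\<close> would be null for \<open>Q\<close>, hence for \<open>P\<close>; taking
  complements, \<open>P\<close> would be the same point mass. Nondegeneracy of mixtures and of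
  reweighted laws thus reduces to comparing null sets.\<close>

lemma nondegenerate_probs_absolutely_continuous:
  assumes P: "P \<in> nondegenerate_probs M" and Q: "prob_space Q" "sets Q = sets M"
    and ac: "\<And>A. A \<in> sets M \<Longrightarrow> measure Q A = 0 \<Longrightarrow> measure P A = 0"
  shows "Q \<in> nondegenerate_probs M"
proof -
  interpret P: prob_space P using P by (rule nondegenerate_probsD)
  note sP = nondegenerate_probsD(2,3)[OF P]
  have "Q \<noteq> return M x" if x: "x \<in> space M" for x
  proof
    assume Qx: "Q = return M x"
    have null: "measure P A = 0" if "A \<in> sets M" "x \<notin> A" for A
      using ac[OF that(1)] that by (simp add: Qx measure_return)
    have "P = return M x"
    proof (rule measure_eqI)
      fix A assume "A \<in> sets P"
      then have A: "A \<in> sets M" by (simp add: sP)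
      show "emeasure P A = emeasure (return M x) A"
      proof (cases "x \<in> A")
        case True
        then have "measure P (space P - A) = 0" using A null[of "space M - A"] by (simp add: sP)
        then have "measure P A = 1" using P.prob_compl[of A] A by (simp add: sP)
        then show ?thesis using A True by (simp add: P.emeasure_eq_measure)
      next
        case False
        then show ?thesis using A null[of A] by (simp add: P.emeasure_eq_measure)
      qed
    qed (simp add: sP)
    then show False using P x by (auto simp: nondegenerate_probs_def)
  qed
  then show ?thesis using Q by (auto simp: nondegenerate_probs_def)
qed

section \<open>Mixtures and pushforwards\<close>

lemma prob_space_mixture:
  assumes "prob_space P" "prob_space Q" "sets P = sets Q" "0 \<le> \<alpha>" "\<alpha> \<le> 1"
  shows "prob_space (mixture \<alpha> P Q)"
proof (rule prob_spaceI)
  have "space P = space Q" using assms(3) by (rule sets_eq_imp_space_eq)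
  then have "emeasure (mixture \<alpha> P Q) (space P) = ennreal \<alpha> * 1 + ennreal (1 - \<alpha>) * 1"
    using assms prob_space.emeasure_space_1[of P] prob_space.emeasure_space_1[of Q]
    by (subst emeasure_mixture) auto
  also have "\<dots> = 1" using assms by (simp flip: ennreal_plus)
  finally show "emeasure (mixture \<alpha> P Q) (space (mixture \<alpha> P Q)) = 1" by simp
qed

lemma measure_mixture:
  assumes "prob_space P" "prob_space Q" "sets P = sets Q" "0 \<le> \<alpha>" "\<alpha> \<le> 1" "A \<in> sets P"
  shows "measure (mixture \<alpha> P Q) A = \<alpha> * measure P A + (1 - \<alpha>) * measure Q A"
proof -
  interpret P: prob_space P by fact
  interpret Q: prob_space Q by fact
  have "emeasure (mixture \<alpha> P Q) A = ennreal (\<alpha> * measure P A + (1 - \<alpha>) * measure Q A)"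
    using assms by (simp add: emeasure_mixture P.emeasure_eq_measure Q.emeasure_eq_measure
        ennreal_mult ennreal_plus)
  then show ?thesis
    using assms by (simp add: measure_def[of "mixture \<alpha> P Q"] del: ennreal_plus)
qed

lemma prob_space_measure_eqI:
  assumes "prob_space P" "prob_space Q" "sets P = sets Q"
    and "\<And>A. A \<in> sets P \<Longrightarrow> measure P A = measure Q A"
  shows "P = Q"
  using assms by (intro measure_eqI)
    (auto simp: finite_measure.emeasure_eq_measure prob_space.finite_measure)

text \<open>The positive weight on \<open>P\<close> makes every null set of the mixture null for
  \<open>P\<close>, whatever law \<open>Q\<close> is.\<close>

lemma mixture_nondegenerate:
  assumes P: "P \<in> nondegenerate_probs M" and Q: "prob_space Q" "sets Q = sets M"
    and \<alpha>: "0 < \<alpha>" "\<alpha> \<le> 1"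
  shows "mixture \<alpha> P Q \<in> nondegenerate_probs M"
proof (rule nondegenerate_probs_absolutely_continuous[OF P])
  note P' = nondegenerate_probsD[OF P]
  show "prob_space (mixture \<alpha> P Q)" using P' Q \<alpha> by (intro prob_space_mixture) auto
  show "sets (mixture \<alpha> P Q) = sets M" using P' by simp
  show "measure P A = 0" if "A \<in> sets M" "measure (mixture \<alpha> P Q) A = 0" for A
  proof -
    have "\<alpha> * measure P A + (1 - \<alpha>) * measure Q A = 0"
      using that P' Q \<alpha> by (simp add: measure_mixture)
    then have "\<alpha> * measure P A = 0"
      using \<alpha> by (subst (asm) add_nonneg_eq_0_iff) auto
    then show ?thesis using \<alpha> by simp
  qed
qed

text \<open>Since \<open>k'\<close> undoes \<open>k\<close>, an image law concentrated at
  \<open>x\<close> would push forward under \<open>k'\<close> to \<open>P\<close>, making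
  \<open>P\<close> the point mass at \<open>k' x\<close>.\<close>

lemma nondegenerate_probs_distr:
  assumes P: "P \<in> nondegenerate_probs M"
    and k[measurable]: "k \<in> M \<rightarrow>\<^sub>M M" and k'[measurable]: "k' \<in> M \<rightarrow>\<^sub>M M"
    and inv: "\<And>x. x \<in> space M \<Longrightarrow> k' (k x) = x"
  shows "distr P M k \<in> nondegenerate_probs M"
proof -
  note P' = nondegenerate_probsD[OF P]
  have kP[measurable]: "k \<in> P \<rightarrow>\<^sub>M M" using k P'(2) by (simp cong: measurable_cong_sets)
  have "distr P M k \<noteq> return M x" if x: "x \<in> space M" for x
  proof
    assume "distr P M k = return M x"
    then have "distr (distr P M k) M k' = return M (k' x)"
      using x by (simp add: distr_return)
    moreover have "distr (distr P M k) M k' = distr P M (\<lambda>x. x)"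
      by (subst distr_distr) (auto simp: P' inv intro!: distr_cong)
    moreover have "distr P M (\<lambda>x. x) = P" using P' by (intro distr_id2) simp
    ultimately have "P = return M (k' x)" by simp
    moreover have "k' x \<in> space M" using x measurable_space[OF k'] by blast
    ultimately show False using P by (auto simp: nondegenerate_probs_def)
  qed
  then show ?thesis
    using prob_space.prob_space_distr[OF P'(1) kP] by (auto simp: nondegenerate_probs_def)
qed

lemma distr_mixture:
  assumes "sets P = sets Q" "k \<in> P \<rightarrow>\<^sub>M N"
  shows "distr (mixture \<alpha> P Q) N k = mixture \<alpha> (distr P N k) (distr Q N k)"
proof (rule measure_eqI)
  have "space P = space Q" using assms(1) by (rule sets_eq_imp_space_eq)
  moreover have "k \<in> Q \<rightarrow>\<^sub>M N" "k \<in> mixture \<alpha> P Q \<rightarrow>\<^sub>M N"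
    using assms by (auto cong: measurable_cong_sets)
  moreover fix A assume "A \<in> sets (distr (mixture \<alpha> P Q) N k)"
  ultimately show "emeasure (distr (mixture \<alpha> P Q) N k) A
      = emeasure (mixture \<alpha> (distr P N k) (distr Q N k)) A"
    using assms by (simp add: emeasure_distr emeasure_mixture measurable_sets)
qed simp

lemma mixture_half_commute:
  assumes "sets P = sets Q"
  shows "mixture (1/2) P Q = mixture (1/2) Q P"
  using assms by (intro measure_eqI) (auto simp: emeasure_mixture add.commute)

section \<open>Reweighting a law on a set and on its complement\<close>

text \<open>
  Conditional probabilities given \<open>B\<close> and its complement could be degenerate; positive weights
  on both parts keep the law equivalent to \<open>P\<close>.
\<close>

definition reweight :: "'x measure \<Rightarrow> 'x set \<Rightarrow> real \<Rightarrow> real \<Rightarrow> 'x measure" where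
  "reweight P B u v = density P (\<lambda>x. ennreal u * indicator B x + ennreal v * indicator (space P - B) x)"

lemma sets_reweight [simp]: "sets (reweight P B u v) = sets P"
  and space_reweight [simp]: "space (reweight P B u v) = space P"
  by (simp_all add: reweight_def)

lemma measure_reweight:
  assumes "prob_space P" "B \<in> sets P" "A \<in> sets P" "0 \<le> u" "0 \<le> v"
  shows "emeasure (reweight P B u v) A = ennreal (u * measure P (A \<inter> B) + v * measure P (A - B))"
    and "measure (reweight P B u v) A = u * measure P (A \<inter> B) + v * measure P (A - B)"
proof -
  interpret P: prob_space P by fact
  note [measurable] = assms(2,3)
  have A: "A \<subseteq> space P" using assms(3) by (rule sets.sets_into_space)
  have "emeasure (reweight P B u v) A
      = (\<integral>\<^sup>+x. ennreal u * indicator (A \<inter> B) x + ennreal v * indicator (A - B) x \<partial>P)"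
    unfolding reweight_def using assms A
    by (subst emeasure_density) (auto intro!: nn_integral_cong split: split_indicator)
  also have "\<dots> = ennreal u * emeasure P (A \<inter> B) + ennreal v * emeasure P (A - B)"
    by (subst nn_integral_add) (auto simp: nn_integral_cmult_indicator)
  finally show *: "emeasure (reweight P B u v) A
      = ennreal (u * measure P (A \<inter> B) + v * measure P (A - B))"
    using assms by (simp add: P.emeasure_eq_measure ennreal_mult ennreal_plus)
  show "measure (reweight P B u v) A = u * measure P (A \<inter> B) + v * measure P (A - B)"
    using assms by (simp add: measure_def[of "reweight P B u v"] * del: ennreal_plus)
qed

lemma measure_split:
  assumes "prob_space P" "B \<in> sets P" "A \<in> sets P"
  shows "measure P A = measure P (A \<inter> B) + measure P (A - B)"
proof -
  interpret P: prob_space P by fact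
  have "measure P ((A \<inter> B) \<union> (A - B)) = measure P (A \<inter> B) + measure P (A - B)"
    using assms by (intro P.finite_measure_Union) auto
  then show ?thesis by (simp add: Int_Diff_Un)
qed

text \<open>Assumption \<open>one\<close> normalises the total mass. As both weights are positive, a
  null set has parts inside and outside \<open>B\<close> that are both null for
  \<open>P\<close>.\<close>

lemma reweight_nondegenerate:
  assumes P: "P \<in> nondegenerate_probs M" and B: "B \<in> sets M" and uv: "0 < u" "0 < v"
    and one: "u * measure P B + v * (1 - measure P B) = 1"
  shows "reweight P B u v \<in> nondegenerate_probs M"
proof (rule nondegenerate_probs_absolutely_continuous[OF P])
  note P' = nondegenerate_probsD[OF P]
  interpret P: prob_space P by fact
  have B': "B \<in> sets P" "B \<subseteq> space P" using B P' sets.sets_into_space[OF B] by auto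
  show "prob_space (reweight P B u v)"
  proof (rule prob_spaceI)
    have "space P \<inter> B = B" using B'(2) by auto
    then show "emeasure (reweight P B u v) (space (reweight P B u v)) = 1"
      using uv B' one P.prob_compl[OF B'(1)]
      by (simp add: measure_reweight P.prob_space_axioms del: ennreal_plus)
  qed
  show "sets (reweight P B u v) = sets M" by (simp add: P')
  show "measure P A = 0" if "A \<in> sets M" "measure (reweight P B u v) A = 0" for A
  proof -
    have "u * measure P (A \<inter> B) + v * measure P (A - B) = 0"
      using that uv B' by (simp add: measure_reweight(2) P')
    then have "u * measure P (A \<inter> B) = 0" "v * measure P (A - B) = 0"
      using uv by (subst (asm) add_nonneg_eq_0_iff; auto)+
    then show ?thesis using measure_split[of P B A] that B' uv by (simp add: P')
  qed
qed

section \<open>Distance from a law to its half mixture with an image\<close>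

text \<open>The hypothesis on \<open>d\<close> compares mixtures with a common component. As
  \<open>k\<close> acts trivially on \<open>B\<close>, only half of the mass of \<open>P\<close>
  outside \<open>B\<close> has to move. So \<open>P\<close> is split into a part that stays and a
  part, of mass \<open>m\<close>, that is pushed by \<open>k\<close>; the distance is then at most
  \<open>m\<close>. The summand \<delta> is the price for keeping the moved part
  nondegenerate.\<close>

lemma dist_half_mixture_distr_le:
  assumes P: "P \<in> nondegenerate_probs M" and B: "B \<in> sets M"
    and k[measurable]: "k \<in> M \<rightarrow>\<^sub>M M" and k': "k' \<in> M \<rightarrow>\<^sub>M M"
    and inv: "\<And>x. x \<in> space M \<Longrightarrow> k' (k x) = x" "\<And>x. x \<in> space M \<Longrightarrow> k (k' x) = x"
    and fixB: "\<And>x. x \<in> B \<Longrightarrow> k x = x"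
    and d: "\<And>P Q1 Q2 \<alpha>. P \<in> nondegenerate_probs M \<Longrightarrow> Q1 \<in> nondegenerate_probs M \<Longrightarrow>
           Q2 \<in> nondegenerate_probs M \<Longrightarrow> 0 < \<alpha> \<Longrightarrow> \<alpha> < 1 \<Longrightarrow>
           d (mixture \<alpha> P Q1) (mixture \<alpha> P Q2) \<le> 1 - \<alpha>"
    and \<delta>: "0 < \<delta>" "\<delta> < 1 / 2"
  shows "d P (mixture (1/2) P (distr P M k)) \<le> (1 - measure P B) / 2 + \<delta>"
proof -
  note P' = nondegenerate_probsD[OF P]
  interpret P: prob_space P by fact
  define a where "a = measure P B"
  \<comment> \<open>The mass of the moved part: half of \<open>P\<close> outside \<open>B\<close>
    plus a fraction \<delta> of \<open>P\<close> on \<open>B\<close>. The second term keeps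
    \<open>m\<close> positive even if \<open>a = 1\<close>.\<close>
  define m where "m = (1 - a) / 2 + \<delta> * a"
  have a: "0 \<le> a" "a \<le> 1" by (simp_all add: a_def)
  have m0: "m > 0"
  proof (cases "a = 1")
    case False
    then show ?thesis using a \<delta> by (simp add: m_def add_pos_nonneg)
  qed (use \<delta> in \<open>simp add: m_def\<close>)
  \<comment> \<open>With \<delta> below 1/2, \<open>m\<close> is at most 1/2, so
    \<open>1 - m\<close> is an admissible weight.\<close>
  have "\<delta> * a \<le> 1 / 2 * a" using a \<delta> by (intro mult_right_mono) auto
  then have m1: "m < 1" by (simp add: m_def field_simps)
  have m\<delta>: "m \<le> (1 - a) / 2 + \<delta>" using a \<delta> by (simp add: m_def mult_left_le)
  \<comment> \<open>Relative to \<open>P\<close>, the component \<open>?R\<close> with weight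
    \<open>1 - m\<close> has density \<open>1 - \<delta>\<close> on \<open>B\<close> and 1/2
    elsewhere; \<open>?Q\<close> with weight \<open>m\<close> has \<delta> and 1/2. These add up to
    1, and dividing by the weights gives laws of mass 1.\<close>
  let ?R = "reweight P B ((1 - \<delta>) / (1 - m)) ((1 / 2) / (1 - m))"
  let ?Q = "reweight P B (\<delta> / m) ((1 / 2) / m)"
  have B': "B \<in> sets P" "B \<subseteq> space M" using B P' sets.sets_into_space[OF B] by auto
  have "(1 - \<delta>) * a + 1 / 2 * (1 - a) = 1 - m" "\<delta> * a + 1 / 2 * (1 - a) = m"
    by (simp_all add: m_def field_simps)
  moreover have "(1 - \<delta>) / (1 - m) * a + 1 / 2 / (1 - m) * (1 - a)
      = ((1 - \<delta>) * a + 1 / 2 * (1 - a)) / (1 - m)"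
    "\<delta> / m * a + 1 / 2 / m * (1 - a) = (\<delta> * a + 1 / 2 * (1 - a)) / m"
    by (simp_all only: add_divide_distrib times_divide_eq_left)
  ultimately have one: "(1 - \<delta>) / (1 - m) * a + 1 / 2 / (1 - m) * (1 - a) = 1"
    "\<delta> / m * a + 1 / 2 / m * (1 - a) = 1"
    using m0 m1 by (metis divide_self less_irrefl diff_gt_0_iff_gt)+
  have R: "?R \<in> nondegenerate_probs M"
    by (rule reweight_nondegenerate[OF P B])
      (use \<delta> m1 one in \<open>simp_all only: a_def[symmetric], simp_all\<close>)
  have Q: "?Q \<in> nondegenerate_probs M"
    by (rule reweight_nondegenerate[OF P B])
      (use \<delta> m0 one in \<open>simp_all only: a_def[symmetric], simp_all\<close>)
  have Qk: "distr ?Q M k \<in> nondegenerate_probs M"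
    using Q k k' inv(1) by (rule nondegenerate_probs_distr)
  note R' = nondegenerate_probsD[OF R] and Q' = nondegenerate_probsD[OF Q]
    and Qk' = nondegenerate_probsD[OF Qk]
  have kP: "k \<in> P \<rightarrow>\<^sub>M M" using k P'(2) by (simp cong: measurable_cong_sets)
  have kQ: "k \<in> ?Q \<rightarrow>\<^sub>M M" using k Q'(2) by (simp cong: measurable_cong_sets)
  have mR: "(1 - m) * measure ?R A = (1 - \<delta>) * measure P (A \<inter> B) + 1/2 * measure P (A - B)"
    and mQ: "m * measure ?Q A = \<delta> * measure P (A \<inter> B) + 1/2 * measure P (A - B)"
    if "A \<in> sets P" for A
    using m0 m1 \<delta> that B'
    by (simp_all add: measure_reweight P.prob_space_axioms distrib_left)
      (simp add: field_simps)
  have "mixture (1 - m) ?R ?Q = P"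
  proof (rule prob_space_measure_eqI)
    show "prob_space (mixture (1 - m) ?R ?Q)"
      using R' Q' m0 m1 by (intro prob_space_mixture) auto
    fix A assume "A \<in> sets (mixture (1 - m) ?R ?Q)"
    then have A: "A \<in> sets P" by simp
    have "measure (mixture (1 - m) ?R ?Q) A = (1 - m) * measure ?R A + m * measure ?Q A"
      using R'(1) Q'(1) m0 m1 A by (simp add: measure_mixture)
    also have "\<dots> = measure P (A \<inter> B) + measure P (A - B)"
      unfolding mR[OF A] mQ[OF A] by (simp add: left_diff_distrib)
    finally have "measure (mixture (1 - m) ?R ?Q) A = measure P (A \<inter> B) + measure P (A - B)" .
    then show "measure (mixture (1 - m) ?R ?Q) A = measure P A"
      using measure_split[of P B A] A B' by (simp add: P')
  qed (simp_all add: P')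
  \<comment> \<open>Pushing \<open>?Q\<close> alone leaves all mass on \<open>B\<close> in place and
    replaces half of the mass outside \<open>B\<close> by its image, which is what the half mixture
    does.\<close>
  moreover have "mixture (1 - m) ?R (distr ?Q M k) = mixture (1/2) P (distr P M k)"
  proof (rule prob_space_measure_eqI)
    have Pk: "prob_space (distr P M k)" by (rule P.prob_space_distr[OF kP])
    show "prob_space (mixture (1 - m) ?R (distr ?Q M k))"
      using R' Qk' m0 m1 by (intro prob_space_mixture) auto
    show "prob_space (mixture (1/2) P (distr P M k))"
      using P' Pk by (intro prob_space_mixture) auto
    show "sets (mixture (1 - m) ?R (distr ?Q M k)) = sets (mixture (1/2) P (distr P M k))"
      by simp
    fix A assume "A \<in> sets (mixture (1 - m) ?R (distr ?Q M k))"
    then have A: "A \<in> sets P" "A \<in> sets M" by (simp_all add: P')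
    define A' where "A' = k -` A \<inter> space M"
    have A': "A' \<in> sets P" using A k by (simp add: A'_def P')
    \<comment> \<open>As \<open>k\<close> fixes \<open>B\<close> pointwise, \<open>A\<close> and its
      preimage meet \<open>B\<close> in the same set; hence \<delta> cancels below.\<close>
    have "x \<in> A' \<inter> B \<longleftrightarrow> x \<in> A \<inter> B" for x
      using B'(2) fixB[of x] by (auto simp: A'_def)
    then have AB: "A' \<inter> B = A \<inter> B" by blast
    have "measure (mixture (1 - m) ?R (distr ?Q M k)) A
        = (1 - m) * measure ?R A + m * measure ?Q A'"
      using R' Qk' m0 m1 A kQ by (simp add: measure_mixture measure_distr A'_def P')
    also have "\<dots> = measure P (A \<inter> B) + 1/2 * measure P (A - B) + 1/2 * measure P (A' - B)"
      unfolding mR[OF A(1)] mQ[OF A'] AB by (simp add: left_diff_distrib)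
    finally have 1: "measure (mixture (1 - m) ?R (distr ?Q M k)) A
        = measure P (A \<inter> B) + 1/2 * measure P (A - B) + 1/2 * measure P (A' - B)" .
    have "measure (mixture (1/2) P (distr P M k)) A = 1/2 * measure P A + 1/2 * measure P A'"
      using P' Pk A kP by (simp add: measure_mixture measure_distr A'_def)
    then show "measure (mixture (1 - m) ?R (distr ?Q M k)) A
        = measure (mixture (1/2) P (distr P M k)) A"
      using 1 measure_split[OF P.prob_space_axioms B'(1) A(1)]
        measure_split[OF P.prob_space_axioms B'(1) A'] unfolding AB by argo
  qed
  ultimately have "d P (mixture (1/2) P (distr P M k)) \<le> 1 - (1 - m)"
    using d[OF R Q Qk, of "1 - m"] m0 m1 by simp
  then show ?thesis using m\<delta> by (simp add: a_def)
qed

section \<open>Inverses and powers of transformations\<close>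

text \<open>The inverse in \<open>BijGroup\<close> is \<open>inv_into\<close> cut off to
  \<open>space M\<close>, so the cancellation laws are stated there; membership in \<open>G\<close>
  also makes it measurable.\<close>

lemma transformation_inverse:
  assumes "measurable_transformation_group M G" "g \<in> G"
  obtains g' where "g' \<in> G" "\<And>x. x \<in> space M \<Longrightarrow> g' (g x) = x"
    "\<And>x. x \<in> space M \<Longrightarrow> g (g' x) = x"
proof -
  have G: "subgroup G (BijGroup (space M))"
    using assms(1) by (simp add: measurable_transformation_group_def)
  have g: "g \<in> Bij (space M)"
    using subgroup.mem_carrier[OF G assms(2)] by (simp add: BijGroup_def)
  then have bij: "bij_betw g (space M) (space M)" by (simp add: Bij_def)
  let ?g' = "inv\<^bsub>BijGroup (space M)\<^esub> g"
  have g': "?g' = restrict (inv_into (space M) g) (space M)"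
    using g by (rule inv_BijGroup)
  show thesis
  proof
    show "?g' \<in> G" using G assms(2) by (rule subgroup.m_inv_closed)
    show "?g' (g x) = x" if "x \<in> space M" for x
      using that bij by (simp add: g' bij_betw_apply bij_betw_inv_into_left)
    show "g (?g' x) = x" if "x \<in> space M" for x
      using that bij by (simp add: g' bij_betw_inv_into_right)
  qed
qed

lemma transformation_pow:
  assumes "measurable_transformation_group M G" "g \<in> G"
  shows "g [^]\<^bsub>BijGroup (space M)\<^esub> (n::nat) \<in> G"
    and "x \<in> space M \<Longrightarrow> g x = x \<Longrightarrow> (g [^]\<^bsub>BijGroup (space M)\<^esub> n) x = x"
proof -
  have G: "subgroup G (BijGroup (space M))"
    using assms(1) by (simp add: measurable_transformation_group_def)
  have "g [^]\<^bsub>BijGroup (space M)\<^esub> n \<in> G \<and>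
      (x \<in> space M \<longrightarrow> g x = x \<longrightarrow> (g [^]\<^bsub>BijGroup (space M)\<^esub> n) x = x)"
  proof (induction n)
    case 0
    have "\<one>\<^bsub>BijGroup (space M)\<^esub> x = x" if "x \<in> space M"
      using that by (simp add: BijGroup_def)
    then show ?case using subgroup.one_closed[OF G] by (simp add: nat_pow_0)
  next
    case (Suc n)
    let ?p = "g [^]\<^bsub>BijGroup (space M)\<^esub> n"
    have carrier: "carrier (BijGroup (space M)) = Bij (space M)" by (simp add: BijGroup_def)
    have pG: "?p \<in> G" using Suc by blast
    have "?p \<in> Bij (space M)" "g \<in> Bij (space M)"
      using subgroup.mem_carrier[OF G pG] subgroup.mem_carrier[OF G assms(2)]
      unfolding carrier by blast+
    moreover have "a \<otimes>\<^bsub>BijGroup (space M)\<^esub> b = compose (space M) a b"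
      if "a \<in> Bij (space M)" "b \<in> Bij (space M)" for a b
      using that by (simp add: BijGroup_def)
    \<comment> \<open>The power recursion multiplies by \<open>g\<close> on the right, so
      \<open>g\<close> acts first and returns the fixed point to the induction hypothesis.\<close>
    ultimately have "?p \<otimes>\<^bsub>BijGroup (space M)\<^esub> g = compose (space M) ?p g"
      by blast
    then have "(?p \<otimes>\<^bsub>BijGroup (space M)\<^esub> g) x = x" if "x \<in> space M" "g x = x"
      using Suc that by (simp only: compose_eq simp_thms)
    moreover have "?p \<otimes>\<^bsub>BijGroup (space M)\<^esub> g \<in> G"
      using G pG assms(2) by (rule subgroup.m_closed)
    ultimately show ?case unfolding nat_pow_Suc by blast
  qed
  then show "g [^]\<^bsub>BijGroup (space M)\<^esub> n \<in> G"
    "x \<in> space M \<Longrightarrow> g x = x \<Longrightarrow> (g [^]\<^bsub>BijGroup (space M)\<^esub> n) x = x" by auto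
qed

section \<open>Unbounded displacement for one fixed set\<close>

text \<open>Treats a single pair \<open>g\<close>, \<open>B\<close>, as the supremum in
  \<open>Delta\<close> need not be attained. A finite supremum would bound the infimum in
  \<open>G1\<close> by \<open>2 * K\<close> uniformly in \<open>n\<close>, against its
  divergence.\<close>

lemma SUP_eq_infinity_of_fixing_transformation:
  fixes d :: "'x measure \<Rightarrow> 'x measure \<Rightarrow> real" and D :: "'t \<Rightarrow> 't \<Rightarrow> real"
  assumes G: "measurable_transformation_group M G"
    and d: "\<And>P Q1 Q2 \<alpha>. P \<in> nondegenerate_probs M \<Longrightarrow> Q1 \<in> nondegenerate_probs M \<Longrightarrow>
           Q2 \<in> nondegenerate_probs M \<Longrightarrow> 0 < \<alpha> \<Longrightarrow> \<alpha> < 1 \<Longrightarrow>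
           d (mixture \<alpha> P Q1) (mixture \<alpha> P Q2) \<le> 1 - \<alpha>"
    and D: "pseudometric_on \<Theta> D"
    and T: "T \<in> nondegenerate_probs M \<rightarrow> \<Theta>"
    and eq: "equivariant M G h (nondegenerate_probs M) T"
    and P: "P \<in> nondegenerate_probs M"
    and g: "g \<in> G1 M G \<Theta> h D" and B: "B \<in> sets M" and fixB: "\<And>x. x \<in> B \<Longrightarrow> g x = x"
    and \<epsilon>: "(1 - measure P B) / 2 < \<epsilon>"
  shows "(SUP Q\<in>{Q\<in>nondegenerate_probs M. d P Q < \<epsilon>}. ereal (D (T P) (T Q))) = \<infinity>"
proof (rule ccontr)
  assume fin: "\<not> ?thesis"
  let ?N = "nondegenerate_probs M"
  note P' = nondegenerate_probsD[OF P]
  interpret P: prob_space P by fact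
  have gG: "g \<in> G" using g by (simp add: G1_def)
  \<comment> \<open>The ball around \<open>P\<close> is open, so an intermediate \<open>e\<close>
    secures a strict gap to \<epsilon>; the bound 1/4 keeps \<delta> below 1/2.\<close>
  obtain e where e: "(1 - measure P B) / 2 < e" "e < \<epsilon>" using dense[OF \<epsilon>] by blast
  define \<delta> where "\<delta> = min (1/4) (e - (1 - measure P B) / 2)"
  have "\<delta> \<le> 1/4" "\<delta> \<le> e - (1 - measure P B) / 2"
    unfolding \<delta>_def by (rule min.cobounded1, rule min.cobounded2)
  then have \<delta>: "0 < \<delta>" "\<delta> < 1/2" "(1 - measure P B) / 2 + \<delta> < \<epsilon>"
    using e by (simp add: \<delta>_def, linarith+)
  have meas: "k \<in> M \<rightarrow>\<^sub>M M" if "k \<in> G" for k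
    using G that by (auto simp: measurable_transformation_group_def)
  have Bs: "B \<subseteq> space M" using B by (rule sets.sets_into_space)
  have mixN: "mixture (1/2) P (distr P M k) \<in> ?N" if "k \<in> G" for k
    using P P.prob_space_distr[of k M] meas[OF that]
    by (intro mixture_nondegenerate) (auto simp: P' cong: measurable_cong_sets)
  obtain K :: real where K: "\<And>Q. Q \<in> ?N \<Longrightarrow> d P Q < \<epsilon> \<Longrightarrow> D (T P) (T Q) \<le> K"
  proof -
    let ?S = "SUP Q\<in>{Q\<in>?N. d P Q < \<epsilon>}. ereal (D (T P) (T Q))"
    have *: "ereal (D (T P) (T Q)) \<le> ?S" if "Q \<in> ?N" "d P Q < \<epsilon>" for Q
      using that by (intro SUP_upper) auto
    show thesis
    proof (cases ?S)
      case (real r)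
      then show thesis using * by (intro that[of r]) auto
    next
      \<comment> \<open>A supremum of minus infinity means that the ball is empty, so any bound
        serves.\<close>
      case MInf
      then show thesis using * by (intro that[of 0]) fastforce
    qed (use fin in simp)
  qed
  have bound: "(INF \<theta>\<in>\<Theta>. ereal (D \<theta> (h (g [^]\<^bsub>BijGroup (space M)\<^esub> n) \<theta>))) \<le> ereal (2 * K)"
    for n :: nat
  proof -
    define k where "k = g [^]\<^bsub>BijGroup (space M)\<^esub> n"
    have kG: "k \<in> G" unfolding k_def using G gG by (rule transformation_pow)
    have kB: "k x = x" if "x \<in> B" for x
      unfolding k_def using that fixB Bs by (intro transformation_pow[OF G gG]) auto
    obtain k' where k'G: "k' \<in> G" and inv: "\<And>x. x \<in> space M \<Longrightarrow> k' (k x) = x"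
      "\<And>x. x \<in> space M \<Longrightarrow> k (k' x) = x"
      using transformation_inverse[OF G kG] by blast
    have k'B: "k' x = x" if "x \<in> B" for x
      using inv(1)[of x] kB[OF that] that Bs by auto
    note [measurable] = meas[OF kG] meas[OF k'G]
    have kP: "k \<in> P \<rightarrow>\<^sub>M M" "k' \<in> P \<rightarrow>\<^sub>M M"
      using meas kG k'G P'(2) by (auto cong: measurable_cong_sets)
    define Q where "Q = mixture (1/2) P (distr P M k)"
    define Q' where "Q' = mixture (1/2) P (distr P M k')"
    have N: "Q \<in> ?N" "Q' \<in> ?N" unfolding Q_def Q'_def using kG k'G mixN by auto
    have "d P Q \<le> (1 - measure P B) / 2 + \<delta>" unfolding Q_def
      by (rule dist_half_mixture_distr_le[where k' = k'])
        (fact P B meas[OF kG] meas[OF k'G] inv kB d \<delta>)+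
    then have Q: "D (T P) (T Q) \<le> K" using \<delta> N by (intro K) auto
    \<comment> \<open>The same estimate with \<open>k\<close> and \<open>k'\<close> exchanged, since
      \<open>k'\<close> fixes \<open>B\<close> as well.\<close>
    have "d P Q' \<le> (1 - measure P B) / 2 + \<delta>" unfolding Q'_def
      by (rule dist_half_mixture_distr_le[where k' = k])
        (fact P B meas[OF kG] meas[OF k'G] inv k'B d \<delta>)+
    then have Q': "D (T P) (T Q') \<le> K" using \<delta> N by (intro K) auto
    \<comment> \<open>Pushing \<open>Q'\<close> by \<open>k\<close> turns its components
      \<open>P\<close> and \<open>distr P M k'\<close> into \<open>distr P M k\<close> and
      \<open>P\<close>. The equal weights make the order immaterial, so the result is
      \<open>Q\<close>.\<close>
    have "distr (distr P M k') M k = distr P M (\<lambda>x. x)"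
      using kP by (subst distr_distr) (auto simp: P' inv intro!: distr_cong)
    also have "\<dots> = P" using P' by (intro distr_id2) simp
    finally have "distr Q' M k = mixture (1/2) (distr P M k) P"
      unfolding Q'_def using kP by (simp add: distr_mixture P')
    also have "\<dots> = Q" unfolding Q_def by (rule mixture_half_commute) (simp add: P')
    finally have TQ: "T Q = h k (T Q')"
      using eq kG N unfolding equivariant_def by metis
    have \<Theta>: "T P \<in> \<Theta>" "T Q \<in> \<Theta>" "T Q' \<in> \<Theta>" using T P N by auto
    \<comment> \<open>The triangle inequality through \<open>T P\<close> makes \<open>T Q'\<close> a
      witness that the infimum is at most \<open>2 * K\<close>.\<close>
    have "D (T Q') (T Q) \<le> D (T Q') (T P) + D (T P) (T Q)" "D (T Q') (T P) = D (T P) (T Q')"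
      using D \<Theta> unfolding pseudometric_on_def by blast+
    then have "D (T Q') (h k (T Q')) \<le> 2 * K" using Q Q' TQ by simp
    then show ?thesis unfolding k_def[symmetric]
      using \<Theta>(3) by (intro INF_lower2) auto
  qed
  have "(\<lambda>n::nat. INF \<theta>\<in>\<Theta>. ereal (D \<theta> (h (g [^]\<^bsub>BijGroup (space M)\<^esub> n) \<theta>))) \<longlonglongrightarrow> \<infinity>"
    using g by (simp add: G1_def)
  then have "\<infinity> \<le> ereal (2 * K)"
    by (rule LIMSEQ_le_const2) (use bound in auto)
  then show False by simp
qed

section \<open>Passage to the supremum over fixed sets\<close>

theorem theorem3p1:
  fixes M :: "'x measure" and \<Theta> :: "'t set"
    and G :: "('x \<Rightarrow> 'x) set" and h :: "('x \<Rightarrow> 'x) \<Rightarrow> 't \<Rightarrow> 't"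
    and d :: "'x measure \<Rightarrow> 'x measure \<Rightarrow> real" and D :: "'t \<Rightarrow> 't \<Rightarrow> real"
    and T :: "'x measure \<Rightarrow> 't" and P :: "'x measure"
  assumes "measurable_transformation_group M G"
    and "induced_group M G \<Theta> h"
    and "pseudometric_on (nondegenerate_probs M) d"
    and "(SUP (P, Q)\<in>nondegenerate_probs M \<times> nondegenerate_probs M. ereal (d P Q)) = 1"
    and "\<And>P Q1 Q2 \<alpha>. P \<in> nondegenerate_probs M \<Longrightarrow> Q1 \<in> nondegenerate_probs M \<Longrightarrow>
           Q2 \<in> nondegenerate_probs M \<Longrightarrow> 0 < \<alpha> \<Longrightarrow> \<alpha> < 1 \<Longrightarrow>
           d (mixture \<alpha> P Q1) (mixture \<alpha> P Q2) \<le> 1 - \<alpha>"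
    and "pseudometric_on \<Theta> D"
    and "(SUP (\<theta>1, \<theta>2)\<in>\<Theta> \<times> \<Theta>. ereal (D \<theta>1 \<theta>2)) = \<infinity>"
    and "G1 M G \<Theta> h D \<noteq> {}"
    and "T \<in> nondegenerate_probs M \<rightarrow> \<Theta>"
    and "equivariant M G h (nondegenerate_probs M) T"
    and "P \<in> nondegenerate_probs M"
  shows "breakdown_point (nondegenerate_probs M) T P d D \<le> ereal ((1 - Delta M G \<Theta> h D P) / 2)"
proof -
  let ?S = "{measure P B | B. B \<in> sets M \<and>
    (\<exists>g\<in>G1 M G \<Theta> h D. restrict g B = restrict \<one>\<^bsub>BijGroup (space M)\<^esub> B)}"
  interpret P: prob_space P using assms(11) by (rule nondegenerate_probsD)
  \<comment> \<open>Any element of \<open>G1\<close> fixes the empty set pointwise.\<close>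
  have "measure P {} \<in> ?S"
    using assms(8) by (intro CollectI exI[of _ "{}"]) (auto simp: restrict_def)
  then have ne: "?S \<noteq> {}" by blast
  have "Sup ?S \<le> 1" by (rule cSup_least[OF ne]) auto
  have main: "breakdown_point (nondegenerate_probs M) T P d D \<le> ereal \<epsilon>"
    if \<epsilon>: "(1 - Delta M G \<Theta> h D P) / 2 < \<epsilon>" for \<epsilon>
  proof -
    \<comment> \<open>Rearranged so that some \<open>B\<close> exceeds
      \<open>1 - 2 * \<epsilon>\<close> in mass, which is
      \<open>(1 - measure P B) / 2 < \<epsilon>\<close>.\<close>
    have "1 - 2 * \<epsilon> < Sup ?S" using \<epsilon> by (simp add: Delta_def)
    then obtain s where "s \<in> ?S" "1 - 2 * \<epsilon> < s" using less_cSupD[OF ne] by blast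
    then obtain B g where B: "B \<in> sets M" "1 - 2 * \<epsilon> < measure P B" and g: "g \<in> G1 M G \<Theta> h D"
      and r: "restrict g B = restrict \<one>\<^bsub>BijGroup (space M)\<^esub> B" by blast
    have "g x = x" if "x \<in> B" for x
      using fun_cong[OF r, of x] that sets.sets_into_space[OF B(1)] by (auto simp: BijGroup_def)
    then have "(SUP Q\<in>{Q\<in>nondegenerate_probs M. d P Q < \<epsilon>}. ereal (D (T P) (T Q))) = \<infinity>"
      using assms B g
      by (intro SUP_eq_infinity_of_fixing_transformation[where G = G and \<Theta> = \<Theta> and h = h
            and g = g and B = B]) auto
    \<comment> \<open>Only positive \<epsilon> enter \<open>breakdown_point\<close>; positivity
      follows because \<open>Delta\<close> is at most 1.\<close>
    moreover have "\<epsilon> > 0" using \<epsilon> \<open>Sup ?S \<le> 1\<close> by (simp add: Delta_def)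
    ultimately show ?thesis unfolding breakdown_point_def by (intro Inf_lower) auto
  qed
  show ?thesis
  \<comment> \<open>\<open>main\<close> needs a strict inequality, so the bound is reached from
    above in the extended reals.\<close>
  proof (rule dense_ge)
    fix y assume "ereal ((1 - Delta M G \<Theta> h D P) / 2) < y"
    then show "breakdown_point (nondegenerate_probs M) T P d D \<le> y"
      using main by (cases y) auto
  qed
qed

end
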